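(* Let $1\le m\le n$, let $M(q)=(M_{ij}(q))$ be a smooth symmetric positive definite $n\times n$ matrix-valued function of $q\in\mathbb R^n$, and let $V(q)$ be a smooth function. Let $i,j,k,\ldots$ range over $1,\dots,n$ and $\alpha,\beta,\gamma$ over $1,\dots,n-m$. Consider the following two systems of PDEs. Controlled Lagrangian matching PDEs, for an unknown symmetric matrix-valued function $\widehat T=(\widehat T_{ij}(q))$ and an unknown function $\widehat V(q)$: for all $\alpha,\beta,\gamma$, $$\frac{\partial V}{\partial q^\alpha}-\widehat T_{\alpha i}M^{ij}\frac{\partial\widehat V}{\partial q^j}=0,\qquad \widehat J_{\alpha\beta\gamma}+\widehat J_{\beta\gamma\alpha}+\widehat J_{\gamma\alpha\beta}=0,$$ $$\widehat J_{\alpha\beta\gamma}=\frac12\widehat T_{\gamma s}M^{sk}\left(\frac{\partial\widehat T_{\alpha\beta}}{\partial q^k}-\widehat T_{\alpha i}\Gamma^i_{\beta k}-\widehat T_{\beta i}\Gamma^i_{\alpha k}\right).$$ IDA-PBC matching PDEs, for an unknown symmetric matrix-valued function $\widehat M=(\widehat M_{ij}(q))$ and an unknown function $\widehat V(q)$: for all $\alpha,\beta,\gamma$, $$\frac{\partial V}{\partial q^\alpha}-\widehat M_{\alpha i}M^{ij}\frac{\partial\widehat V}{\partial q^j}=0,\qquad S_{\alpha\beta\gamma}+S_{\beta\gamma\alpha}+S_{\gamma\alpha\beta}=0,$$ $$S_{\alpha\beta\gamma}=-\frac12\widehat M_{\gamma\ell}M^{\ell t}\frac{\partial\widehat M_{\alpha\beta}}{\partial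 q^t}-\frac12\frac{\partial M^{rs}}{\partial q^\gamma}\widehat M_{r\alpha}\widehat M_{s\beta}.$$ Then the two systems of PDEs are the same: if one replaces $\widehat T_{ij}$ by $\widehat M_{ij}$ in the controlled Lagrangian matching PDEs, one obtains the IDA-PBC matching PDEs, each equation being equivalent to the corresponding equation with the same indices.
   Context: Repeated indices are summed over $1,\dots,n$. $M^{ij}$ denotes the $(i,j)$ entry of $M^{-1}$. $\Gamma^k_{ij}$ are the Christoffel symbols of the second kind of $M$: $$\Gamma^k_{ij}=\frac12M^{k\ell}\left(\frac{\partial M_{\ell j}}{\partial q^i}+\frac{\partial M_{i\ell}}{\partial q^j}-\frac{\partial M_{ij}}{\partial q^\ell}\right).$$ Here $m$ is the number of controls of the mechanical system with $n$ degrees of freedom, mass matrix $M$ and potential $V$, and controls act in the coordinate directions $n-m+1,\dots,n$. (In the controlled Lagrangian method $\widehat T=M\widehat M^{-1}M$, where there $\widehat M$ is the new mass matrix; in the statement $\widehat T$ and $\widehat M$ are each treated as the unknown of the respective system.) *)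

theory Defs
  imports "HOL-Analysis.Analysis"
begin

type_synonym 'n point = "(real, 'n) vec"
type_synonym 'n scalar_field = "'n point \<Rightarrow> real"
type_synonym 'n matrix_field = "'n point \<Rightarrow> ('n point, 'n) vec"

text \<open>The coordinate indices are the elements of a finite linearly ordered type \<^typ>\<open>'n\<close>, so
  \<open>n = CARD('n)\<close>, and \<open>i\<close> stands for its position \<open>card {..i}\<close>, a number in \<open>1, \<dots>, n\<close>.
  The uncontrolled directions (those of \<open>\<alpha>, \<beta>, \<gamma>\<close>) are the first \<open>n - m\<close>.\<close>

definition uncontrolled :: "nat \<Rightarrow> ('n::{finite,linorder}) set" where
  "uncontrolled m = {i. card {..i} \<le> CARD('n) - m}"

definition partial :: "'n::finite \<Rightarrow> 'n scalar_field \<Rightarrow> 'n scalar_field" where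
  "partial k f q = deriv (\<lambda>t. f (q + t *\<^sub>R axis k 1)) 0"

fun iterated_partial :: "'n::finite list \<Rightarrow> 'n scalar_field \<Rightarrow> 'n scalar_field" where
  "iterated_partial [] f = f"
| "iterated_partial (k # ks) f = partial k (iterated_partial ks f)"

text \<open>Frechet differentiability of all iterated partial derivatives makes each of them
  continuous, so this is the class \<open>C\<^sup>\<infinity>\<close>.\<close>

definition smooth :: "('n::finite) scalar_field \<Rightarrow> bool" where
  "smooth f \<longleftrightarrow> (\<forall>ks. iterated_partial ks f differentiable_on UNIV)"

definition smooth_matrix :: "('n::finite) matrix_field \<Rightarrow> bool" where
  "smooth_matrix A \<longleftrightarrow> (\<forall>i j. smooth (\<lambda>q. A q $ i $ j))"

definition differentiable_matrix :: "('n::finite) matrix_field \<Rightarrow> bool" where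
  "differentiable_matrix A \<longleftrightarrow> (\<forall>i j. (\<lambda>q. A q $ i $ j) differentiable_on UNIV)"

definition symmetric_matrix :: "real^'n^'n \<Rightarrow> bool" where
  "symmetric_matrix A \<longleftrightarrow> transpose A = A"

definition positive_definite :: "real^'n^'n \<Rightarrow> bool" where
  "positive_definite A \<longleftrightarrow> (\<forall>x. x \<noteq> 0 \<longrightarrow> x \<bullet> (A *v x) > 0)"

definition inv_entry :: "('n::finite) matrix_field \<Rightarrow> 'n \<Rightarrow> 'n \<Rightarrow> 'n scalar_field" where
  "inv_entry M i j q = matrix_inv (M q) $ i $ j"

text \<open>\<open>christoffel M k i j\<close> is \<open>\<Gamma>\<^sup>k\<^sub>i\<^sub>j\<close>.\<close>

definition christoffel ::
  "('n::finite) matrix_field \<Rightarrow> 'n \<Rightarrow> 'n \<Rightarrow> 'n \<Rightarrow> 'n scalar_field" where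
  "christoffel M k i j q =
     1/2 * (\<Sum>l\<in>UNIV. inv_entry M k l q *
       (partial i (\<lambda>x. M x $ l $ j) q + partial j (\<lambda>x. M x $ i $ l) q
        - partial l (\<lambda>x. M x $ i $ j) q))"

definition J_hat ::
  "('n::finite) matrix_field \<Rightarrow> 'n matrix_field \<Rightarrow> 'n \<Rightarrow> 'n \<Rightarrow> 'n \<Rightarrow> 'n scalar_field" where
  "J_hat M T \<alpha> \<beta> \<gamma> q =
     1/2 * (\<Sum>s\<in>UNIV. \<Sum>k\<in>UNIV. T q $ \<gamma> $ s * inv_entry M s k q *
       (partial k (\<lambda>x. T x $ \<alpha> $ \<beta>) q
        - (\<Sum>i\<in>UNIV. T q $ \<alpha> $ i * christoffel M i \<beta> k q)
        - (\<Sum>i\<in>UNIV. T q $ \<beta> $ i * christoffel M i \<alpha> k q)))"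

definition CL_potential_eq ::
  "('n::finite) matrix_field \<Rightarrow> 'n scalar_field \<Rightarrow> 'n matrix_field \<Rightarrow> 'n scalar_field
     \<Rightarrow> 'n \<Rightarrow> 'n point \<Rightarrow> bool" where
  "CL_potential_eq M V T Vh \<alpha> q \<longleftrightarrow>
     partial \<alpha> V q
     - (\<Sum>i\<in>UNIV. \<Sum>j\<in>UNIV. T q $ \<alpha> $ i * inv_entry M i j q * partial j Vh q) = 0"

definition CL_kinetic_eq ::
  "('n::finite) matrix_field \<Rightarrow> 'n matrix_field \<Rightarrow> 'n \<Rightarrow> 'n \<Rightarrow> 'n \<Rightarrow> 'n point \<Rightarrow> bool" where
  "CL_kinetic_eq M T \<alpha> \<beta> \<gamma> q \<longleftrightarrow> J_hat M T \<alpha> \<beta> \<gamma> q + J_hat M T \<beta> \<gamma> \<alpha> q + J_hat M T \<gamma> \<alpha> \<beta> q = 0"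

definition S_hat ::
  "('n::finite) matrix_field \<Rightarrow> 'n matrix_field \<Rightarrow> 'n \<Rightarrow> 'n \<Rightarrow> 'n \<Rightarrow> 'n scalar_field" where
  "S_hat M Mh \<alpha> \<beta> \<gamma> q =
     - (1/2) * (\<Sum>l\<in>UNIV. \<Sum>t\<in>UNIV.
         Mh q $ \<gamma> $ l * inv_entry M l t q * partial t (\<lambda>x. Mh x $ \<alpha> $ \<beta>) q)
     - 1/2 * (\<Sum>r\<in>UNIV. \<Sum>s\<in>UNIV.
         partial \<gamma> (inv_entry M r s) q * Mh q $ r $ \<alpha> * Mh q $ s $ \<beta>)"

definition IDA_potential_eq ::
  "('n::finite) matrix_field \<Rightarrow> 'n scalar_field \<Rightarrow> 'n matrix_field \<Rightarrow> 'n scalar_field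
     \<Rightarrow> 'n \<Rightarrow> 'n point \<Rightarrow> bool" where
  "IDA_potential_eq M V Mh Vh \<alpha> q \<longleftrightarrow>
     partial \<alpha> V q
     - (\<Sum>i\<in>UNIV. \<Sum>j\<in>UNIV. Mh q $ \<alpha> $ i * inv_entry M i j q * partial j Vh q) = 0"

definition IDA_kinetic_eq ::
  "('n::finite) matrix_field \<Rightarrow> 'n matrix_field \<Rightarrow> 'n \<Rightarrow> 'n \<Rightarrow> 'n \<Rightarrow> 'n point \<Rightarrow> bool" where
  "IDA_kinetic_eq M Mh \<alpha> \<beta> \<gamma> q \<longleftrightarrow> S_hat M Mh \<alpha> \<beta> \<gamma> q + S_hat M Mh \<beta> \<gamma> \<alpha> q + S_hat M Mh \<gamma> \<alpha> \<beta> q = 0"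

text \<open>The admissible unknowns of both systems. Only first derivatives of the unknowns occur, so
  differentiability is what the equations need in order to make classical sense.\<close>

definition admissible :: "('n::finite) matrix_field \<Rightarrow> 'n scalar_field \<Rightarrow> bool" where
  "admissible A Vh \<longleftrightarrow>
     (\<forall>q. symmetric_matrix (A q)) \<and> differentiable_matrix A \<and> Vh differentiable_on UNIV"

definition CL_solution ::
  "nat \<Rightarrow> ('n::{finite,linorder}) matrix_field \<Rightarrow> 'n scalar_field
     \<Rightarrow> 'n matrix_field \<Rightarrow> 'n scalar_field \<Rightarrow> bool" where
  "CL_solution m M V T Vh \<longleftrightarrow> admissible T Vh \<and>
     (\<forall>q. \<forall>\<alpha>\<in>uncontrolled m. CL_potential_eq M V T Vh \<alpha> q) \<and>
     (\<forall>q. \<forall>\<alpha>\<in>uncontrolled m. \<forall>\<beta>\<in>uncontrolled m. \<forall>\<gamma>\<in>uncontrolled m. CL_kinetic_eq M T \<alpha> \<beta> \<gamma> q)"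

definition IDA_solution ::
  "nat \<Rightarrow> ('n::{finite,linorder}) matrix_field \<Rightarrow> 'n scalar_field
     \<Rightarrow> 'n matrix_field \<Rightarrow> 'n scalar_field \<Rightarrow> bool" where
  "IDA_solution m M V Mh Vh \<longleftrightarrow> admissible Mh Vh \<and>
     (\<forall>q. \<forall>\<alpha>\<in>uncontrolled m. IDA_potential_eq M V Mh Vh \<alpha> q) \<and>
     (\<forall>q. \<forall>\<alpha>\<in>uncontrolled m. \<forall>\<beta>\<in>uncontrolled m. \<forall>\<gamma>\<in>uncontrolled m. IDA_kinetic_eq M Mh \<alpha> \<beta> \<gamma> q)"

end

theory Submission
  imports Defs
begin

text \<open>
  The two potential equations are literally equal, so everything rests on the kinetic ones, where
  the two cyclic sums are negatives of each other. Write \<open>N = M\<^sup>-\<^sup>1\<close> and \<open>P = T N\<close>, so that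
  \<open>P\<^sub>\<gamma>\<^sup>k = T\<^sub>\<gamma>\<^sub>s N\<^sup>s\<^sup>k\<close>.

  On the IDA-PBC side, \<open>\<partial>\<^sub>\<gamma> N = - N (\<partial>\<^sub>\<gamma> M) N\<close> turns the second term of \<open>S\<close> into
  \<open>+ 1/2 P\<^sub>\<alpha>\<^sup>k P\<^sub>\<beta>\<^sup>l \<partial>\<^sub>\<gamma> M\<^sub>k\<^sub>l\<close> (\<open>S_hat_eq\<close>). On the controlled Lagrangian side, expanding
  \<open>P\<^sub>\<gamma>\<^sup>k T\<^sub>\<alpha>\<^sub>i \<Gamma>\<^sup>i\<^sub>\<beta>\<^sub>k\<close> gives half of
  \<open>P\<^sub>\<gamma>\<^sup>k P\<^sub>\<alpha>\<^sup>l (\<partial>\<^sub>\<beta> M\<^sub>l\<^sub>k + \<partial>\<^sub>k M\<^sub>\<beta>\<^sub>l - \<partial>\<^sub>l M\<^sub>\<beta>\<^sub>k)\<close> (\<open>J_hat_eq\<close>). The last two terms,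
  once contracted, are together antisymmetric in \<open>\<gamma>\<close> and \<open>\<alpha>\<close>. Each \<open>J\<close> contains two such contributions, and
  over the cyclic permutations they cancel in pairs. The first term is symmetric in \<open>\<gamma>\<close> and
  \<open>\<alpha>\<close>, so its six occurrences pair up to \<open>- 1/2 P\<^sub>\<alpha>\<^sup>k P\<^sub>\<beta>\<^sup>l \<partial>\<^sub>\<gamma> M\<^sub>k\<^sub>l\<close> and its cyclic
  permutations, which is minus the corresponding contribution of \<open>S\<close>. The terms in \<open>\<partial>T\<close> are
  opposite even before summing.

  The cancellation is a matter of indices alone; the only analysis is the differentiability of the
  inverse matrix, which Cramer's rule reduces to that of determinants.
\<close>

section \<open>Differentiating the inverse of a matrix\<close>

lemma matrix_inv_mult:
  fixes A :: "real^'n^'n"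
  assumes "det A \<noteq> 0"
  shows "matrix_inv A ** A = mat 1" "A ** matrix_inv A = mat 1"
proof -
  have "\<exists>B. A ** B = mat 1 \<and> B ** A = mat 1"
    using assms by (simp add: invertible_det_nz[symmetric] invertible_def)
  then have "A ** matrix_inv A = mat 1 \<and> matrix_inv A ** A = mat 1"
    unfolding matrix_inv_def by (rule someI_ex)
  then show "matrix_inv A ** A = mat 1" "A ** matrix_inv A = mat 1"
    by simp_all
qed

lemma matrix_inv_entry_cramer:
  fixes A :: "real^'n^'n"
  assumes "det A \<noteq> 0"
  shows "matrix_inv A $ i $ j = det (\<chi> r c. if c = i then axis j 1 $ r else A $ r $ c) / det A"
proof -
  have "A *v (matrix_inv A *v axis j 1) = axis j 1"
    by (simp add: matrix_vector_mul_assoc matrix_inv_mult assms)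
  then have "matrix_inv A *v axis j 1 =
      (\<chi> k. det (\<chi> r c. if c = k then axis j 1 $ r else A $ r $ c) / det A)"
    using cramer[OF assms] by blast
  then show ?thesis
    by (simp add: matrix_vector_mul_component column_def vec_eq_iff
        matrix_vector_mult_basis)
qed

lemma differentiable_det:
  fixes A :: "real \<Rightarrow> real^'n^'n"
  assumes "\<And>i j. (\<lambda>t. A t $ i $ j) differentiable (at x)"
  shows "(\<lambda>t. det (A t)) differentiable (at x)"
proof -
  have prod: "(\<lambda>t. \<Prod>i\<in>I. A t $ i $ p i) differentiable (at x)" if "finite I" for I p
    using that by induction (auto intro!: derivative_intros assms)
  show ?thesis
    unfolding det_def by (auto intro!: derivative_intros prod)
qed

lemma differentiable_matrix_inv_entry:
  fixes A :: "real \<Rightarrow> real^'n^'n"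
  assumes diff: "\<And>i j. (\<lambda>t. A t $ i $ j) differentiable (at x)"
    and nz: "\<And>t. det (A t) \<noteq> 0"
  shows "(\<lambda>t. matrix_inv (A t) $ i $ j) differentiable (at x)"
proof -
  have "(\<lambda>t. det (\<chi> r c. if c = i then axis j 1 $ r else A t $ r $ c)) differentiable (at x)"
  proof (rule differentiable_det)
    show "(\<lambda>t. (\<chi> r c. if c = i then axis j 1 $ r else A t $ r $ c) $ r $ c)
        differentiable (at x)" for r c
      by (cases "c = i") (auto simp: diff)
  qed
  then show ?thesis
    by (simp add: matrix_inv_entry_cramer nz differentiable_divide differentiable_det diff)
qed

text \<open>Differentiating \<open>A\<^sup>-\<^sup>1 A = 1\<close> entrywise gives \<open>(A\<^sup>-\<^sup>1)' A + A\<^sup>-\<^sup>1 A' = 0\<close>, which is then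
  multiplied by \<open>A\<^sup>-\<^sup>1\<close> from the right.\<close>

lemma deriv_matrix_inv_entry:
  fixes A :: "real \<Rightarrow> real^'n^'n" and A' :: "'n \<Rightarrow> 'n \<Rightarrow> real"
  assumes A: "\<And>i j. ((\<lambda>t. A t $ i $ j) has_real_derivative A' i j) (at x)"
    and nz: "\<And>t. det (A t) \<noteq> 0"
  shows "deriv (\<lambda>t. matrix_inv (A t) $ r $ s) x =
    - (\<Sum>k\<in>UNIV. \<Sum>l\<in>UNIV. matrix_inv (A x) $ r $ k * A' k l * matrix_inv (A x) $ l $ s)"
proof -
  define B where "B t = matrix_inv (A t)" for t
  define B' where "B' i j = deriv (\<lambda>t. B t $ i $ j) x" for i j
  have "(\<lambda>t. A t $ i $ j) differentiable (at x)" for i j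
    using A real_differentiable_def by blast
  then have B: "((\<lambda>t. B t $ i $ j) has_real_derivative B' i j) (at x)" for i j
    unfolding B_def B'_def
    by (metis DERIV_deriv_iff_real_differentiable differentiable_matrix_inv_entry nz)
  have BA: "(\<Sum>k\<in>UNIV. B t $ i $ k * A t $ k $ j) = (if i = j then 1 else 0)" for t i j
    using matrix_inv_mult(1)[OF nz, of t]
    by (simp add: B_def matrix_matrix_mult_def mat_def vec_eq_iff)
  have AB: "(\<Sum>k\<in>UNIV. A x $ i $ k * B x $ k $ j) = (if i = j then 1 else 0)" for i j
    using matrix_inv_mult(2)[OF nz, of x]
    by (simp add: B_def matrix_matrix_mult_def mat_def vec_eq_iff)
  have product_rule: "(\<Sum>k\<in>UNIV. B' r k * A x $ k $ j) = - (\<Sum>k\<in>UNIV. B x $ r $ k * A' k j)" for j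
  proof -
    have "((\<lambda>t. \<Sum>k\<in>UNIV. B t $ r $ k * A t $ k $ j) has_real_derivative
        (\<Sum>k\<in>UNIV. B' r k * A x $ k $ j + A' k j * B x $ r $ k)) (at x)"
      by (intro DERIV_sum DERIV_mult A B)
    then have "(\<Sum>k\<in>UNIV. B' r k * A x $ k $ j + A' k j * B x $ r $ k) = 0"
      unfolding BA using DERIV_const DERIV_unique by blast
    then show ?thesis
      by (simp add: sum.distrib mult.commute)
  qed
  have "B' r s = (\<Sum>k\<in>UNIV. B' r k * (if k = s then 1 else 0))"
    by (simp add: if_distrib cong: if_cong)
  also have "\<dots> = (\<Sum>k\<in>UNIV. \<Sum>j\<in>UNIV. B' r k * (A x $ k $ j * B x $ j $ s))"
    by (simp add: AB[symmetric] sum_distrib_left)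
  also have "\<dots> = (\<Sum>j\<in>UNIV. \<Sum>k\<in>UNIV. B' r k * A x $ k $ j * B x $ j $ s)"
    by (subst sum.swap) (simp add: mult.assoc)
  also have "\<dots> = (\<Sum>j\<in>UNIV. (\<Sum>k\<in>UNIV. B' r k * A x $ k $ j) * B x $ j $ s)"
    by (simp add: sum_distrib_right)
  also have "\<dots> = - (\<Sum>j\<in>UNIV. \<Sum>k\<in>UNIV. B x $ r $ k * A' k j * B x $ j $ s)"
    by (simp add: product_rule sum_distrib_right sum_negf)
  also have "\<dots> = - (\<Sum>k\<in>UNIV. \<Sum>l\<in>UNIV. B x $ r $ k * A' k l * B x $ l $ s)"
    by (subst sum.swap) simp
  finally show ?thesis
    by (simp add: B'_def B_def)
qed

lemma has_derivative_partial:
  assumes "f differentiable (at q)"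
  shows "((\<lambda>t. f (q + t *\<^sub>R axis k 1)) has_real_derivative partial k f q) (at 0)"
proof -
  have "(f \<circ> (\<lambda>t. q + t *\<^sub>R axis k 1)) differentiable (at 0)"
    using assms by (intro differentiable_chain_at) (auto intro!: derivative_intros)
  then show ?thesis
    by (simp add: partial_def o_def DERIV_deriv_iff_real_differentiable)
qed

lemma partial_inv_entry:
  fixes M :: "('n::finite) matrix_field"
  assumes diff: "\<And>i j. (\<lambda>x. M x $ i $ j) differentiable (at q)"
    and nz: "\<And>x. det (M x) \<noteq> 0"
  shows "partial \<gamma> (inv_entry M r s) q =
    - (\<Sum>k\<in>UNIV. \<Sum>l\<in>UNIV.
        inv_entry M r k q * partial \<gamma> (\<lambda>x. M x $ k $ l) q * inv_entry M l s q)"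
  using deriv_matrix_inv_entry[of "\<lambda>t. M (q + t *\<^sub>R axis \<gamma> 1)", OF has_derivative_partial[OF diff] nz]
  by (simp add: inv_entry_def partial_def)

section \<open>Positive definite symmetric matrices\<close>

lemma positive_definite_det_nonzero:
  assumes "positive_definite A"
  shows "det A \<noteq> 0"
proof -
  have "x = 0" if "A *v x = 0" for x
    using assms that unfolding positive_definite_def by (metis inner_zero_right less_irrefl)
  then have "invertible A"
    by (simp add: invertible_left_inverse matrix_left_invertible_ker)
  then show ?thesis
    by (simp add: invertible_det_nz)
qed

lemma symmetric_matrix_entry: "symmetric_matrix A \<Longrightarrow> A $ i $ j = A $ j $ i"
  unfolding symmetric_matrix_def by (metis transpose_def vec_lambda_beta)

lemma symmetric_matrix_inv:
  assumes "symmetric_matrix A" and "det A \<noteq> 0"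
  shows "symmetric_matrix (matrix_inv A)"
proof -
  let ?B = "matrix_inv A"
  have "transpose ?B ** A = mat 1"
    using assms by (metis matrix_inv_mult(2) matrix_transpose_mul symmetric_matrix_def transpose_mat)
  then have "transpose ?B = ?B"
    by (metis assms(2) matrix_inv_mult(2) matrix_mul_assoc matrix_mul_lid matrix_mul_rid)
  then show ?thesis
    by (simp add: symmetric_matrix_def)
qed

section \<open>The kinetic equations\<close>

definition raised :: "('n::finite) matrix_field \<Rightarrow> 'n matrix_field \<Rightarrow> 'n \<Rightarrow> 'n \<Rightarrow> 'n scalar_field" where
  "raised M T a k q = (\<Sum>s\<in>UNIV. T q $ a $ s * inv_entry M s k q)"

text \<open>In matrix notation, \<open>mass_term M T a b c = (P (\<partial>\<^sub>c M) P\<^sup>T)\<^sub>a\<^sub>b\<close>. Here the derivative has a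
  free index, whereas in \<open>skew_term\<close> it is taken along the row \<open>P\<^sub>a\<close>.\<close>

definition mass_term ::
  "('n::finite) matrix_field \<Rightarrow> 'n matrix_field \<Rightarrow> 'n \<Rightarrow> 'n \<Rightarrow> 'n \<Rightarrow> 'n scalar_field" where
  "mass_term M T a b c q =
     (\<Sum>k\<in>UNIV. \<Sum>l\<in>UNIV. raised M T a k q * raised M T b l q * partial c (\<lambda>x. M x $ k $ l) q)"

definition skew_term ::
  "('n::finite) matrix_field \<Rightarrow> 'n matrix_field \<Rightarrow> 'n \<Rightarrow> 'n \<Rightarrow> 'n \<Rightarrow> 'n scalar_field" where
  "skew_term M T a b c q =
     (\<Sum>k\<in>UNIV. \<Sum>l\<in>UNIV. raised M T a k q * raised M T b l q * partial k (\<lambda>x. M x $ c $ l) q)"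

definition unknown_term ::
  "('n::finite) matrix_field \<Rightarrow> 'n matrix_field \<Rightarrow> 'n \<Rightarrow> 'n \<Rightarrow> 'n \<Rightarrow> 'n scalar_field" where
  "unknown_term M T a b c q =
     (\<Sum>k\<in>UNIV. raised M T c k q * partial k (\<lambda>x. T x $ a $ b) q)"

lemma mass_term_commute:
  assumes "\<And>x. symmetric_matrix (M x)"
  shows "mass_term M T a b c q = mass_term M T b a c q"
proof -
  have "(\<lambda>x. M x $ k $ l) = (\<lambda>x. M x $ l $ k)" for k l
    using symmetric_matrix_entry[OF assms] by auto
  then show ?thesis
    unfolding mass_term_def by (subst sum.swap) (simp add: mult_ac)
qed

lemma sum_eq_raised_sum:
  "(\<Sum>s\<in>UNIV. \<Sum>k\<in>UNIV. T q $ c $ s * inv_entry M s k q * f k) = (\<Sum>k\<in>UNIV. raised M T c k q * f k)"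
  unfolding raised_def sum_distrib_right by (rule sum.swap)

lemma christoffel_contraction:
  "(\<Sum>i\<in>UNIV. T q $ a $ i * christoffel M i b k q) =
     1/2 * (\<Sum>l\<in>UNIV. raised M T a l q *
       (partial b (\<lambda>x. M x $ l $ k) q + partial k (\<lambda>x. M x $ b $ l) q
        - partial l (\<lambda>x. M x $ b $ k) q))"
  unfolding sum_eq_raised_sum[symmetric] christoffel_def sum_distrib_left
  by (simp add: mult_ac)

text \<open>The \<open>skew_term\<close> differences come from the last two derivatives in the Christoffel symbol:
  the contraction with \<open>P\<^sub>c\<^sup>k P\<^sub>a\<^sup>l\<close> is symmetric under exchanging \<open>(c, k)\<close> with \<open>(a, l)\<close>, which
  carries one of these derivatives into the other.\<close>

lemma christoffel_double_contraction:
  "(\<Sum>k\<in>UNIV. raised M T c k q * (\<Sum>i\<in>UNIV. T q $ a $ i * christoffel M i b k q)) =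
     1/2 * (mass_term M T a c b q + skew_term M T c a b q - skew_term M T a c b q)"
proof -
  let ?P = "\<lambda>a k. raised M T a k q"
  let ?D = "\<lambda>c k l. partial c (\<lambda>x. M x $ k $ l) q"
  have "(\<Sum>k\<in>UNIV. ?P c k * (\<Sum>i\<in>UNIV. T q $ a $ i * christoffel M i b k q)) =
      1/2 * (\<Sum>k\<in>UNIV. \<Sum>l\<in>UNIV.
        ?P a l * ?P c k * ?D b l k + ?P c k * ?P a l * ?D k b l - ?P a l * ?P c k * ?D l b k)"
    unfolding christoffel_contraction sum_distrib_left
    by (intro sum.cong refl) (simp add: algebra_simps)
  also have "\<dots> = 1/2 * ((\<Sum>k\<in>UNIV. \<Sum>l\<in>UNIV. ?P a l * ?P c k * ?D b l k)
      + (\<Sum>k\<in>UNIV. \<Sum>l\<in>UNIV. ?P c k * ?P a l * ?D k b l)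
      - (\<Sum>k\<in>UNIV. \<Sum>l\<in>UNIV. ?P a l * ?P c k * ?D l b k))"
    by (simp only: sum.distrib sum_subtractf)
  also have "(\<Sum>k\<in>UNIV. \<Sum>l\<in>UNIV. ?P a l * ?P c k * ?D b l k) = mass_term M T a c b q"
    unfolding mass_term_def by (rule sum.swap)
  also have "(\<Sum>k\<in>UNIV. \<Sum>l\<in>UNIV. ?P a l * ?P c k * ?D l b k) = skew_term M T a c b q"
    unfolding skew_term_def by (rule sum.swap)
  finally show ?thesis
    by (simp add: skew_term_def)
qed

lemma J_hat_eq:
  "J_hat M T a b c q = 1/2 * unknown_term M T a b c q
     - 1/4 * (mass_term M T a c b q + skew_term M T c a b q - skew_term M T a c b q)
     - 1/4 * (mass_term M T b c a q + skew_term M T c b a q - skew_term M T b c a q)"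
proof -
  have "J_hat M T a b c q = 1/2 * (unknown_term M T a b c q
      - (\<Sum>k\<in>UNIV. raised M T c k q * (\<Sum>i\<in>UNIV. T q $ a $ i * christoffel M i b k q))
      - (\<Sum>k\<in>UNIV. raised M T c k q * (\<Sum>i\<in>UNIV. T q $ b $ i * christoffel M i a k q)))"
    unfolding J_hat_def sum_eq_raised_sum[of T q] unknown_term_def
    by (simp only: right_diff_distrib sum_subtractf)
  then show ?thesis
    unfolding christoffel_double_contraction by (simp add: field_simps)
qed

text \<open>The symmetry of \<open>T\<close> and of \<open>M\<^sup>-\<^sup>1\<close> is what makes both outer factors of
  \<open>T (\<partial>M\<^sup>-\<^sup>1) T\<close> equal to \<open>P = T M\<^sup>-\<^sup>1\<close> once the derivative of the inverse is expanded; the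
  minus sign of that derivative flips the sign of the term.\<close>

lemma S_hat_eq:
  fixes M :: "('n::finite) matrix_field"
  assumes diff: "\<And>i j. (\<lambda>x. M x $ i $ j) differentiable (at q)"
    and nz: "\<And>x. det (M x) \<noteq> 0"
    and symM: "symmetric_matrix (M q)" and symT: "symmetric_matrix (T q)"
  shows "S_hat M T a b c q = - 1/2 * unknown_term M T a b c q + 1/2 * mass_term M T a b c q"
proof -
  let ?N = "\<lambda>r s. inv_entry M r s q"
  let ?D = "\<lambda>k l. partial c (\<lambda>x. M x $ k $ l) q"
  have N: "?N l s = ?N s l" for l s
    unfolding inv_entry_def by (intro symmetric_matrix_entry symmetric_matrix_inv symM nz)
  have T: "T q $ i $ j = T q $ j $ i" for i j
    by (rule symmetric_matrix_entry[OF symT])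
  have "(\<Sum>r\<in>UNIV. \<Sum>s\<in>UNIV. partial c (inv_entry M r s) q * T q $ r $ a * T q $ s $ b) =
      - (\<Sum>r\<in>UNIV. \<Sum>s\<in>UNIV. \<Sum>k\<in>UNIV. \<Sum>l\<in>UNIV.
          T q $ a $ r * ?N r k * (T q $ b $ s * ?N s l) * ?D k l)"
    unfolding partial_inv_entry[OF diff nz] T[of _ a] T[of _ b] sum_distrib_right
      sum_negf[symmetric]
    by (simp add: sum_distrib_right N mult_ac)
  also have "(\<Sum>r\<in>UNIV. \<Sum>s\<in>UNIV. \<Sum>k\<in>UNIV. \<Sum>l\<in>UNIV.
          T q $ a $ r * ?N r k * (T q $ b $ s * ?N s l) * ?D k l) =
      (\<Sum>r\<in>UNIV. \<Sum>k\<in>UNIV. T q $ a $ r * ?N r k * (\<Sum>s\<in>UNIV. \<Sum>l\<in>UNIV. T q $ b $ s * ?N s l * ?D k l))"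
    by (subst (2) sum.swap) (simp add: sum_distrib_left mult_ac)
  also have "\<dots> = mass_term M T a b c q"
    unfolding sum_eq_raised_sum[of T q] mass_term_def by (simp add: sum_distrib_left mult_ac)
  finally show ?thesis
    unfolding S_hat_def sum_eq_raised_sum[of T q] unknown_term_def by simp
qed

lemma cyclic_sum_J_hat_eq_minus_S_hat:
  fixes M :: "('n::finite) matrix_field"
  assumes diff: "\<And>i j. (\<lambda>x. M x $ i $ j) differentiable (at q)"
    and nz: "\<And>x. det (M x) \<noteq> 0"
    and symM: "\<And>x. symmetric_matrix (M x)" and symT: "symmetric_matrix (T q)"
  shows "J_hat M T a b c q + J_hat M T b c a q + J_hat M T c a b q =
    - (S_hat M T a b c q + S_hat M T b c a q + S_hat M T c a b q)"
proof -
  have commute: "mass_term M T x y z q = mass_term M T y x z q" for x y z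
    by (rule mass_term_commute[OF symM])
  show ?thesis
    unfolding J_hat_eq S_hat_eq[where M = M and T = T, OF diff nz symM symT]
    using commute[of a b c] commute[of b c a] commute[of c a b]
    by (simp add: field_simps)
qed

lemma CL_kinetic_eq_iff_IDA_kinetic_eq:
  fixes M :: "('n::finite) matrix_field"
  assumes smooth: "smooth_matrix M"
    and sym: "\<And>x. symmetric_matrix (M x)" and pos: "\<And>x. positive_definite (M x)"
    and symT: "symmetric_matrix (T q)"
  shows "CL_kinetic_eq M T a b c q \<longleftrightarrow> IDA_kinetic_eq M T a b c q"
proof -
  have diff: "(\<lambda>x. M x $ i $ j) differentiable (at q)" for i j
  proof -
    \<comment> \<open>smoothness speaks of iterated partials; the empty iteration is the entry itself\<close>
    have "iterated_partial [] (\<lambda>x. M x $ i $ j) differentiable_on UNIV"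
      using smooth unfolding smooth_matrix_def smooth_def by blast
    then show ?thesis
      by (simp add: differentiable_on_def)
  qed
  have "J_hat M T a b c q + J_hat M T b c a q + J_hat M T c a b q =
      - (S_hat M T a b c q + S_hat M T b c a q + S_hat M T c a b q)"
    by (intro cyclic_sum_J_hat_eq_minus_S_hat diff positive_definite_det_nonzero pos sym symT)
  then show ?thesis
    unfolding CL_kinetic_eq_def IDA_kinetic_eq_def by (simp only: neg_equal_0_iff_equal)
qed

section \<open>Equivalence of the matching equations\<close>

theorem theorem3:
  fixes M :: "('n::{finite,linorder}) matrix_field"
    and V :: "'n scalar_field"
    and m :: nat
  assumes "1 \<le> m" and "m \<le> CARD('n)"
    and "smooth_matrix M"
    and "\<And>q. symmetric_matrix (M q)"
    and "\<And>q. positive_definite (M q)"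
    and "smooth V"
  shows "(\<forall>Mh Vh. admissible Mh Vh \<longrightarrow>
            (\<forall>q. \<forall>\<alpha>\<in>uncontrolled m.
               CL_potential_eq M V Mh Vh \<alpha> q \<longleftrightarrow> IDA_potential_eq M V Mh Vh \<alpha> q) \<and>
            (\<forall>q. \<forall>\<alpha>\<in>uncontrolled m. \<forall>\<beta>\<in>uncontrolled m. \<forall>\<gamma>\<in>uncontrolled m.
               CL_kinetic_eq M Mh \<alpha> \<beta> \<gamma> q \<longleftrightarrow> IDA_kinetic_eq M Mh \<alpha> \<beta> \<gamma> q)) \<and>
         (\<forall>Mh Vh. CL_solution m M V Mh Vh \<longleftrightarrow> IDA_solution m M V Mh Vh)"
proof -
  have potential: "CL_potential_eq M V Mh Vh \<alpha> q \<longleftrightarrow> IDA_potential_eq M V Mh Vh \<alpha> q"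
    for Mh Vh \<alpha> q
    by (simp only: CL_potential_eq_def IDA_potential_eq_def)
  have kinetic: "CL_kinetic_eq M Mh \<alpha> \<beta> \<gamma> q \<longleftrightarrow> IDA_kinetic_eq M Mh \<alpha> \<beta> \<gamma> q"
    if "admissible Mh Vh" for Mh \<alpha> \<beta> \<gamma> q and Vh :: "'n scalar_field"
    using that by (intro CL_kinetic_eq_iff_IDA_kinetic_eq assms) (simp add: admissible_def)
  show ?thesis
    unfolding CL_solution_def IDA_solution_def using potential kinetic by blast
qed

end
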